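(* Let $\Omega\subset\mathbb{R}^N$ ($N\geq 1$) be open and let $M$ be a $\Phi$-function on $\Omega$ which is locally integrable, i.e. $\int_K M(x,c)\,dx<\infty$ for every constant $c>0$ and every compact set $K\subset\Omega$. Then any $u\in\mathcal{B}_c(\Omega)$ is $M$-mean continuous, that is: for every $\varepsilon>0$ there exists $\eta=\eta(\varepsilon)>0$ such that for all $h\in\mathbb{R}^N$ with $|h|<\eta$, $$\|\tau_h u-u\|_{L_M(\Omega)}<\varepsilon.$$
   Context: A function $M:\Omega\times[0,\infty)\to[0,\infty]$ is a $\phi$-function if for all $x\in\Omega$ the function $M(x,\cdot)$ is nondecreasing and convex with $M(x,0)=0$, $M(x,s)>0$ for $s>0$, $M(x,s)\to\infty$ as $s\to\infty$, and $M(\cdot,s)$ is measurable for every $s\geq0$. It is a $\Phi$-function if moreover $\lim_{s\to0^+}M(x,s)/s=0$ and $\lim_{s\to+\infty}M(x,s)/s=+\infty$ for all $x\in\Omega$. $L_M(\Omega)$ is the space of measurable $u:\Omega\to\mathbb{R}$ (modulo a.e. equality) with $\int_\Omega M(x,|u(x)|/\lambda)\,dx<\infty$ for some $\lambda>0$, with the Luxemburg norm $\|u\|_{L_M(\Omega)}=\inf\{\lambda>0:\int_\Omega M(x,|u(x)|/\lambda)\,dx\leq1\}$. $\mathcal{B}_c(\Omega)$ is the set of bounded (measurable, real-valued) functions compactly supported in $\Omega$. For $h\in\mathbb{R}^N$, the translation $\tau_hu$ is defined by $\tau_hu(x)=u(x+h)$ if $x\in\Omega$ and $x+h\in\Omega$,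 and $\tau_hu(x)=0$ otherwise in $\mathbb{R}^N$. *)

theory Defs
  imports "HOL-Analysis.Analysis"
begin

text \<open>
  Measurability and integration are with respect to Lebesgue measure. A function on \<open>\<Omega>\<close> is a total
  function whose values outside \<open>\<Omega>\<close> are never used; likewise \<open>M x s\<close> is only used for \<open>s \<ge> 0\<close>.
\<close>

text \<open>
  Convexity is spelled out because \<^typ>\<open>ennreal\<close> is not a real vector space; note \<open>0 * \<infinity> = 0\<close>
  in \<^typ>\<open>ennreal\<close>, so the endpoint cases impose nothing.
\<close>

definition phi_function :: "'a::euclidean_space set \<Rightarrow> ('a \<Rightarrow> real \<Rightarrow> ennreal) \<Rightarrow> bool" where
  "phi_function \<Omega> M \<longleftrightarrow>
    (\<forall>x\<in>\<Omega>.
      mono_on {0..} (M x) \<and>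
      (\<forall>s\<ge>0. \<forall>t\<ge>0. \<forall>a\<in>{0..1}.
        M x (a * s + (1 - a) * t) \<le> ennreal a * M x s + ennreal (1 - a) * M x t) \<and>
      M x 0 = 0 \<and>
      (\<forall>s>0. M x s > 0) \<and>
      (M x \<longlongrightarrow> \<infinity>) at_top) \<and>
    (\<forall>s\<ge>0. (\<lambda>x. M x s) \<in> borel_measurable (lebesgue_on \<Omega>))"

definition Phi_function :: "'a::euclidean_space set \<Rightarrow> ('a \<Rightarrow> real \<Rightarrow> ennreal) \<Rightarrow> bool" where
  "Phi_function \<Omega> M \<longleftrightarrow>
    phi_function \<Omega> M \<and>
    (\<forall>x\<in>\<Omega>.
      ((\<lambda>s. M x s / ennreal s) \<longlongrightarrow> 0) (at_right 0) \<and>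
      ((\<lambda>s. M x s / ennreal s) \<longlongrightarrow> \<infinity>) at_top)"

definition locally_integrable :: "'a::euclidean_space set \<Rightarrow> ('a \<Rightarrow> real \<Rightarrow> ennreal) \<Rightarrow> bool" where
  "locally_integrable \<Omega> M \<longleftrightarrow>
    (\<forall>c>0. \<forall>K. compact K \<and> K \<subseteq> \<Omega> \<longrightarrow> (\<integral>\<^sup>+x. M x c \<partial>lebesgue_on K) < \<infinity>)"

text \<open>
  The norm takes values in \<^typ>\<open>ennreal\<close>, where the infimum of the empty set is \<open>\<infinity>\<close>. Thus it is
  finite exactly when the modular of \<open>u / r\<close> is at most \<open>1\<close> for some \<open>r > 0\<close>; with \<^typ>\<open>real\<close>
  values, a function outside the space could get norm \<open>0\<close>.
\<close>

definition luxemburg_norm ::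
    "'a::euclidean_space set \<Rightarrow> ('a \<Rightarrow> real \<Rightarrow> ennreal) \<Rightarrow> ('a \<Rightarrow> real) \<Rightarrow> ennreal" where
  "luxemburg_norm \<Omega> M u =
    Inf {ennreal r | r. r > 0 \<and> (\<integral>\<^sup>+x. M x (\<bar>u x\<bar> / r) \<partial>lebesgue_on \<Omega>) \<le> 1}"

definition bounded_compactly_supported :: "'a::euclidean_space set \<Rightarrow> ('a \<Rightarrow> real) set" where
  "bounded_compactly_supported \<Omega> =
    {u \<in> borel_measurable (lebesgue_on \<Omega>).
      bounded (u ` \<Omega>) \<and>
      compact (closure {x \<in> \<Omega>. u x \<noteq> 0}) \<and> closure {x \<in> \<Omega>. u x \<noteq> 0} \<subseteq> \<Omega>}"

definition translation :: "'a::euclidean_space set \<Rightarrow> 'a \<Rightarrow> ('a \<Rightarrow> real) \<Rightarrow> 'a \<Rightarrow> real" where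
  "translation \<Omega> h u x = (if x \<in> \<Omega> \<and> x + h \<in> \<Omega> then u (x + h) else 0)"

definition mean_continuous ::
    "'a::euclidean_space set \<Rightarrow> ('a \<Rightarrow> real \<Rightarrow> ennreal) \<Rightarrow> ('a \<Rightarrow> real) \<Rightarrow> bool" where
  "mean_continuous \<Omega> M u \<longleftrightarrow>
    (\<forall>\<epsilon>::real. \<epsilon> > 0 \<longrightarrow> (\<exists>\<eta>::real. \<eta> > 0 \<and> (\<forall>h. norm h < \<eta> \<longrightarrow>
      luxemburg_norm \<Omega> M (\<lambda>x. translation \<Omega> h u x - u x) < ennreal \<epsilon>)))"

end

theory Submission
  imports Defs
begin

text \<open>
  Write \<open>w\<close> for \<open>\<tau>\<^sub>h u - u\<close> with \<open>h\<close> small. It is bounded by a constant \<open>D\<close> and vanishes outside a fixed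
  compact \<open>L \<subseteq> \<Omega>\<close>, so convexity gives \<open>M(x, \<bar>w\<bar>/r) \<le> (\<bar>w\<bar>/D) M(x, D/r)\<close>. Hence the modular of \<open>w/r\<close>
  is controlled by the weighted \<open>L\<^sup>1\<close> norm of \<open>w\<close> on \<open>L\<close> with the integrable weight \<open>M(x, D/r)\<close>.
  Where the weight exceeds \<open>n\<close> its integral is small; elsewhere continuity of translations in
  the unweighted \<open>L\<^sup>1\<close> applies.
\<close>

section \<open>Continuity of translations in the unweighted L1 norm\<close>

lemma measurable_lebesgue_add_right:
  "(\<lambda>x. x + h) \<in> lebesgue \<rightarrow>\<^sub>M (lebesgue :: 'a::euclidean_space measure)"
  using lebesgue_affine_measurable[of "\<lambda>_. 1" h]
  by (simp add: euclidean_representation add.commute)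

text \<open>Lebesgue measure is its own image under the affine map with unit scale factors and shift
  \<open>h\<close>.\<close>

lemma nn_integral_lebesgue_translation:
  fixes f :: "'a::euclidean_space \<Rightarrow> ennreal"
  assumes [measurable]: "f \<in> borel_measurable lebesgue"
  shows "(\<integral>\<^sup>+x. f (x + h) \<partial>lebesgue) = (\<integral>\<^sup>+x. f x \<partial>lebesgue)"
proof -
  have "lebesgue = distr lebesgue lebesgue (\<lambda>x::'a. x + h)"
    using lebesgue_affine_euclidean[of "\<lambda>_. 1" h]
    by (simp add: euclidean_representation add.commute density_1)
  then have "(\<integral>\<^sup>+x. f x \<partial>lebesgue) = (\<integral>\<^sup>+x. f x \<partial>distr lebesgue lebesgue (\<lambda>x::'a. x + h))"
    by simp
  also have "\<dots> = (\<integral>\<^sup>+x. f (x + h) \<partial>lebesgue)"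
    by (intro nn_integral_distr measurable_lebesgue_add_right) simp
  finally show ?thesis by simp
qed

text \<open>A Lebesgue measurable function is an a.e. limit of continuous functions
  \<open>G n\<close>. Truncating these to \<open>[-C, C]\<close> keeps continuity and the limit, and
  makes the constant \<open>C\<close> a dominating function, integrable because \<open>S\<close> has
  finite measure.\<close>

lemma bounded_measurable_continuous_approx:
  fixes f :: "'a::euclidean_space \<Rightarrow> real"
  assumes f: "f \<in> borel_measurable lebesgue" and bound: "\<And>x. \<bar>f x\<bar> \<le> C"
    and S: "S \<in> lmeasurable" and "e > 0"
  obtains g where "continuous_on UNIV g" "(\<integral>\<^sup>+x. ennreal \<bar>f x - g x\<bar> \<partial>lebesgue_on S) < e"
proof -
  have "f measurable_on UNIV"
    using f by (intro lebesgue_measurable_imp_measurable_on) auto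
  then obtain N G where N: "negligible N" and G: "\<And>n. continuous_on UNIV (G n)"
    and lim: "\<And>x. x \<notin> N \<Longrightarrow> (\<lambda>n. G n x) \<longlonglongrightarrow> f x"
    by (auto simp: measurable_on_def)
  define H where "H n x = min C (max (- C) (G n x))" for n x
  have cont: "continuous_on UNIV (H n)" for n
    unfolding H_def by (intro continuous_intros G)
  have [simp]: "S \<in> sets lebesgue"
    using S by (simp add: fmeasurableD)
  have "(\<lambda>n. \<integral>\<^sup>+x. ennreal (norm (f x - H n x)) \<partial>lebesgue_on S) \<longlonglongrightarrow> 0"
  proof (rule nn_integral_dominated_convergence_norm[where w = "\<lambda>_. C"])
    show "H n \<in> borel_measurable (lebesgue_on S)" for n
      using cont continuous_imp_measurable_on_sets_lebesgue continuous_on_subset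
      by (metis \<open>S \<in> sets lebesgue\<close> top_greatest)
    show "f \<in> borel_measurable (lebesgue_on S)"
      using f by (rule measurable_restrict_space1)
    have "0 \<le> C" using bound[of undefined] by linarith
    then have "norm (H n x) \<le> C" for n x
      by (auto simp: H_def)
    then show "AE x in lebesgue_on S. norm (H n x) \<le> C" for n
      by simp
    show "(\<integral>\<^sup>+x. ennreal C \<partial>lebesgue_on S) < \<infinity>"
      using S by (auto simp: emeasure_restrict_space space_restrict_space fmeasurable_def ennreal_mult_less_top)
    have "AE x in lebesgue. x \<notin> N"
      using N by (simp add: negligible_iff_null_sets AE_not_in)
    then show "AE x in lebesgue_on S. (\<lambda>n. H n x) \<longlonglongrightarrow> f x"
    proof (subst AE_restrict_space_iff, simp, elim eventually_mono, intro impI)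
      fix x assume "x \<notin> N"
      then have "(\<lambda>n. H n x) \<longlonglongrightarrow> min C (max (- C) (f x))"
        unfolding H_def by (intro tendsto_intros lim)
      moreover have "min C (max (- C) (f x)) = f x"
        using bound[of x] by linarith
      ultimately show "(\<lambda>n. H n x) \<longlonglongrightarrow> f x" by simp
    qed
  qed auto
  then have "\<forall>\<^sub>F n in sequentially. (\<integral>\<^sup>+x. ennreal (norm (f x - H n x)) \<partial>lebesgue_on S) < e"
    using \<open>e > 0\<close> by (rule order_tendstoD)
  then obtain n where "(\<integral>\<^sup>+x. ennreal \<bar>f x - H n x\<bar> \<partial>lebesgue_on S) < e"
    by (auto dest: eventually_happens)
  with cont show thesis by (rule that)
qed

text \<open>Insert a continuous approximation \<open>g\<close> at both \<open>x + h\<close> and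
  \<open>x\<close>: translation invariance controls the two approximation errors, and uniform
  continuity of \<open>g\<close> on a compact ball controls the remaining difference.\<close>

lemma L1_translation_continuous:
  fixes f :: "'a::euclidean_space \<Rightarrow> real"
  assumes f[measurable]: "f \<in> borel_measurable lebesgue" and bound: "\<And>x. \<bar>f x\<bar> \<le> C"
    and S: "bounded S" "S \<in> sets lebesgue" and "e > 0"
  obtains d :: real where "d > 0"
    "\<And>h. norm h < d \<Longrightarrow> (\<integral>\<^sup>+x. ennreal \<bar>f (x + h) - f x\<bar> \<partial>lebesgue_on S) < ennreal e"
proof -
  from S obtain R where R: "S \<subseteq> cball 0 R"
    using bounded_subset_ballD[of S 0] ball_subset_cball by blast
  \<comment> \<open>The margin 1 keeps \<open>x + h\<close> in the ball for \<open>x\<close> in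
    \<open>S\<close> as soon as \<open>norm h < 1\<close>, which is why the final radius is
    \<open>min d 1\<close>.\<close>
  define B where "B = cball (0::'a) (R + 1)"
  have B[measurable]: "B \<in> sets lebesgue" and lB: "B \<in> lmeasurable" and cB: "compact B"
    by (auto simp: B_def)
  have S_lm: "S \<in> lmeasurable" using S by (rule bounded_set_imp_lmeasurable)
  obtain g where g: "continuous_on UNIV g"
    and fg: "(\<integral>\<^sup>+x. ennreal \<bar>f x - g x\<bar> \<partial>lebesgue_on B) < ennreal (e / 4)"
    using bounded_measurable_continuous_approx[OF f bound lB, of "ennreal (e / 4)"] \<open>e > 0\<close>
    by (metis ennreal_less_zero_iff zero_less_divide_iff zero_less_numeral)
  have [measurable]: "g \<in> borel_measurable lebesgue"
    using g by (simp add: borel_measurable_continuous_onI measurable_completion)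
  define m where "m = measure lebesgue S"
  have emS: "emeasure lebesgue S = ennreal m"
    using fmeasurableD2[OF S_lm] by (simp add: m_def emeasure_eq_ennreal_measure)
  have "m \<ge> 0" by (simp add: m_def)
  \<comment> \<open>Chosen so that the constant \<open>c\<close> integrates to at most
    \<open>e / 4\<close> over \<open>S\<close>; the \<open>+ 1\<close> covers
    \<open>m = 0\<close>.\<close>
  define c where "c = e / (4 * (m + 1))"
  have "c > 0" and cm: "c * m \<le> e / 4"
    using \<open>e > 0\<close> \<open>m \<ge> 0\<close> by (auto simp: c_def field_simps)
  have "uniformly_continuous_on B g"
    using cB g by (meson compact_uniformly_continuous continuous_on_subset top_greatest)
  then obtain d where "d > 0" and d: "\<And>x y. x \<in> B \<Longrightarrow> y \<in> B \<Longrightarrow> dist y x < d \<Longrightarrow> dist (g y) (g x) < c"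
    using \<open>c > 0\<close> unfolding uniformly_continuous_on_def by metis
  show thesis
  proof (rule that[of "min d 1"])
    fix h :: 'a assume h: "norm h < min d 1"
    have SB: "x \<in> B \<and> x + h \<in> B" if "x \<in> S" for x
      using that R h norm_triangle_ineq[of x h] by (auto simp: B_def)
    \<comment> \<open>The cut-off to \<open>B\<close> is part of the function and moves with it, so
      the shifted error is an integral over the whole space and translation invariance
      applies.\<close>
    let ?k = "\<lambda>x. ennreal \<bar>f x - g x\<bar> * indicator B x"
    have [measurable]: "(\<lambda>x. ?k (x + h)) \<in> borel_measurable lebesgue"
      using measurable_compose[OF measurable_lebesgue_add_right, of ?k borel h] by simp
    have "(\<integral>\<^sup>+x. ennreal \<bar>f (x + h) - f x\<bar> \<partial>lebesgue_on S)
        = (\<integral>\<^sup>+x. ennreal \<bar>f (x + h) - f x\<bar> * indicator S x \<partial>lebesgue)"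
      using S by (simp add: nn_integral_restrict_space)
    also have "\<dots> \<le> (\<integral>\<^sup>+x. ?k (x + h) + (?k x + ennreal c * indicator S x) \<partial>lebesgue)"
    proof (rule nn_integral_mono)
      fix x
      show "ennreal \<bar>f (x + h) - f x\<bar> * indicator S x
          \<le> ?k (x + h) + (?k x + ennreal c * indicator S x)"
      proof (cases "x \<in> S")
        case True
        have "\<bar>g (x + h) - g x\<bar> < c"
          using d[of x "x + h"] SB[OF True] h by (auto simp: dist_norm)
        then have "\<bar>f (x + h) - f x\<bar> \<le> \<bar>f (x + h) - g (x + h)\<bar> + (\<bar>f x - g x\<bar> + c)"
          by linarith
        then show ?thesis
          using True SB[OF True] \<open>c > 0\<close> by (simp flip: ennreal_plus)
      qed simp
    qed
    also have "\<dots> = (\<integral>\<^sup>+x. ?k (x + h) \<partial>lebesgue) + ((\<integral>\<^sup>+x. ?k x \<partial>lebesgue) + ennreal c * ennreal m)"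
      using S(2) emS by (simp add: nn_integral_add nn_integral_cmult)
    also have "(\<integral>\<^sup>+x. ?k (x + h) \<partial>lebesgue) = (\<integral>\<^sup>+x. ?k x \<partial>lebesgue)"
      by (rule nn_integral_lebesgue_translation) measurable
    also have "(\<integral>\<^sup>+x. ?k x \<partial>lebesgue) = (\<integral>\<^sup>+x. ennreal \<bar>f x - g x\<bar> \<partial>lebesgue_on B)"
      by (simp add: nn_integral_restrict_space)
    also have "\<dots> + (\<dots> + ennreal c * ennreal m)
        \<le> ennreal (e / 4) + (ennreal (e / 4) + ennreal (e / 4))"
      using fg cm \<open>c > 0\<close> \<open>m \<ge> 0\<close> by (intro add_mono) (auto simp flip: ennreal_mult intro!: ennreal_leI)
    also have "\<dots> < ennreal e"
      using \<open>e > 0\<close> by (simp add: ennreal_less_iff flip: ennreal_plus)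
    finally show "(\<integral>\<^sup>+x. ennreal \<bar>f (x + h) - f x\<bar> \<partial>lebesgue_on S) < ennreal e" .
  qed (use \<open>d > 0\<close> in auto)
qed

text \<open>A function with finite integral is finite a.e., so the truncated integrands eventually
  vanish at almost every point; they are dominated by \<open>g\<close> itself.\<close>

lemma nn_integral_tail_small:
  fixes g :: "'a \<Rightarrow> ennreal"
  assumes g[measurable]: "g \<in> borel_measurable M" and fin: "(\<integral>\<^sup>+x. g x \<partial>M) < \<infinity>" and "e > 0"
  obtains n :: nat where "(\<integral>\<^sup>+x. g x * indicator {x. g x > of_nat n} x \<partial>M) < e"
proof -
  have "(\<lambda>n. \<integral>\<^sup>+x. g x * indicator {x. g x > of_nat n} x \<partial>M) \<longlonglongrightarrow> (\<integral>\<^sup>+x. 0 \<partial>M)"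
  proof (rule nn_integral_dominated_convergence[where w = g])
    show "AE x in M. (\<lambda>n. g x * indicator {x. g x > of_nat n} x) \<longlonglongrightarrow> 0"
      using nn_integral_PInf_AE[OF g less_imp_neq[OF fin]]
    proof (rule eventually_mono)
      fix x assume "g x \<noteq> \<infinity>"
      then obtain k :: nat where k: "g x < of_nat k"
        by (metis ennreal_Ex_less_of_nat infinity_ennreal_def top.not_eq_extremum)
      have "\<forall>\<^sub>F n in sequentially. g x * indicator {x. g x > of_nat n} x = 0"
        using eventually_ge_at_top[of k]
      proof eventually_elim
        case (elim n)
        then have "g x < of_nat n" using k by (meson less_le_trans of_nat_mono)
        then show ?case by simp
      qed
      then show "(\<lambda>n. g x * indicator {x. g x > of_nat n} x) \<longlonglongrightarrow> 0"
        by (rule tendsto_eventually)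
    qed
  qed (use fin in \<open>auto simp: indicator_def\<close>)
  then have "\<forall>\<^sub>F n in sequentially. (\<integral>\<^sup>+x. g x * indicator {x. g x > of_nat n} x \<partial>M) < e"
    using \<open>e > 0\<close> by (intro order_tendstoD) auto
  with that show thesis
    by (auto dest: eventually_happens)
qed

text \<open>Convexity on the segment from 0 to \<open>T\<close>, with weight \<open>t / T\<close> at
  \<open>T\<close>; the other endpoint contributes nothing since \<open>M x 0 = 0\<close>.\<close>

lemma phi_function_le_scaled:
  assumes "phi_function \<Omega> M" "x \<in> \<Omega>" "0 \<le> t" "t \<le> T" "0 < T"
  shows "M x t \<le> ennreal (t / T) * M x T"
proof -
  have conv: "\<forall>s\<ge>0. \<forall>t\<ge>0. \<forall>a\<in>{0..1}.
      M x (a * s + (1 - a) * t) \<le> ennreal a * M x s + ennreal (1 - a) * M x t" and "M x 0 = 0"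
    using assms unfolding phi_function_def by blast+
  have "t / T \<in> {0..1}" using assms by auto
  with conv assms have "M x (t / T * T + (1 - t / T) * 0)
      \<le> ennreal (t / T) * M x T + ennreal (1 - t / T) * M x 0"
    by (meson less_imp_le order_refl)
  then show ?thesis using assms \<open>M x 0 = 0\<close> by simp
qed

section \<open>The modular estimate for translates\<close>

theorem lemma3p1:
  fixes \<Omega> :: "(real ^ 'n) set"
    and M :: "real ^ 'n \<Rightarrow> real \<Rightarrow> ennreal"
    and u :: "real ^ 'n \<Rightarrow> real"
  assumes "open \<Omega>"
    and "Phi_function \<Omega> M"
    and "locally_integrable \<Omega> M"
    and "u \<in> bounded_compactly_supported \<Omega>"
  shows "mean_continuous \<Omega> M u"
  unfolding mean_continuous_def
proof (intro allI impI)
  fix \<epsilon> :: real assume "\<epsilon> > 0"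
  have phi: "phi_function \<Omega> M"
    using assms(2) by (simp add: Phi_function_def)
  have [simp]: "\<Omega> \<in> sets lebesgue"
    using \<open>open \<Omega>\<close> by auto
  define K where "K = closure {x \<in> \<Omega>. u x \<noteq> 0}"
  have u_meas: "u \<in> borel_measurable (lebesgue_on \<Omega>)" and "bounded (u ` \<Omega>)"
    and K: "compact K" "K \<subseteq> \<Omega>"
    using assms(4) by (auto simp: bounded_compactly_supported_def K_def)
  then obtain C where C: "C > 0" "\<And>x. x \<in> \<Omega> \<Longrightarrow> \<bar>u x\<bar> \<le> C"
    by (auto simp: bounded_pos)
  \<comment> \<open>Extension by zero turns the translation into a plain shift: on
    \<open>\<Omega>\<close> the difference is \<open>v (x + h) - v x\<close>, whether or not
    \<open>x + h\<close> lies in \<open>\<Omega>\<close>.\<close>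
  define v where "v x = (if x \<in> \<Omega> then u x else 0)" for x
  have v_meas: "v \<in> borel_measurable lebesgue"
    using u_meas by (simp add: v_def[abs_def] borel_measurable_if)
  have v_bound: "\<bar>v x\<bar> \<le> C" for x
    using C by (simp add: v_def)
  have v_supp: "x \<in> K" if "v x \<noteq> 0" for x
    using that closure_subset[of "{x \<in> \<Omega>. u x \<noteq> 0}"]
    by (auto simp: v_def K_def split: if_splits)
  have trans_eq: "translation \<Omega> h u x - u x = v (x + h) - v x" if "x \<in> \<Omega>" for h x
    using that by (simp add: translation_def v_def)

  obtain \<delta> where "\<delta> > 0" and \<delta>: "(\<Union>x\<in>K. cball x \<delta>) \<subseteq> \<Omega>"
    using compact_subset_open_imp_cball_epsilon_subset[OF \<open>compact K\<close> \<open>open \<Omega>\<close> \<open>K \<subseteq> \<Omega>\<close>] by blast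
  \<comment> \<open>The closed \<open>\<delta>\<close>-neighbourhood of \<open>K\<close>. As a sum
    of two compact sets it is compact; as a union of balls (\<open>L_alt\<close>) it lies in
    \<open>\<Omega>\<close>.\<close>
  define L where "L = (\<Union>x\<in>K. \<Union>y\<in>cball 0 \<delta>. {x + y})"
  have "compact L"
    unfolding L_def by (intro compact_sums' K compact_cball)
  have L_alt: "L = (\<Union>x\<in>K. cball x \<delta>)"
  proof (intro set_eqI iffI)
    fix z assume "z \<in> (\<Union>x\<in>K. cball x \<delta>)"
    then obtain x where "x \<in> K" "norm (z - x) \<le> \<delta>"
      by (auto simp: dist_norm norm_minus_commute)
    then show "z \<in> L"
      unfolding L_def by (intro UN_I[of x] UN_I[of "z - x"]) auto
  qed (force simp: L_def dist_norm)
  have "L \<subseteq> \<Omega>" using \<delta> L_alt by simp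
  have [simp]: "L \<in> sets lebesgue"
    using \<open>compact L\<close> by (simp add: borel_compact)
  have vanish: "v (x + h) - v x = 0" if "x \<notin> L" "norm h < \<delta>" for x h
  proof -
    have "x \<notin> K" using that \<open>\<delta> > 0\<close> by (auto simp: L_alt)
    moreover have "x + h \<notin> K" using that by (auto simp: L_alt dist_norm)
    ultimately show ?thesis using v_supp[of x] v_supp[of "x + h"] by force
  qed

  \<comment> \<open>The modular bound only yields norm at most \<open>r\<close>, so \<open>r\<close>
    is taken strictly below \<open>\<epsilon>\<close>.\<close>
  define r where "r = \<epsilon> / 2"
  \<comment> \<open>\<open>2 * C\<close> bounds the difference of two values of \<open>v\<close>;
    the extra 1 ensures \<open>D \<ge> 1\<close>, hence
    \<open>\<bar>w x\<bar> / D \<le> \<bar>w x\<bar>\<close> below.\<close>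
  define D where "D = 2 * C + 1"
  have "r > 0" "D \<ge> 1" using \<open>\<epsilon> > 0\<close> C by (auto simp: r_def D_def)
  define g where "g x = M x (D / r)" for x
  have "(\<lambda>x. M x (D / r)) \<in> borel_measurable (lebesgue_on \<Omega>)"
    using phi \<open>r > 0\<close> \<open>D \<ge> 1\<close> by (auto simp: phi_function_def)
  then have g_meas[measurable]: "g \<in> borel_measurable (lebesgue_on L)"
    unfolding g_def[abs_def] using \<open>L \<subseteq> \<Omega>\<close> by (rule measurable_restrict_mono)
  have g_fin: "(\<integral>\<^sup>+x. g x \<partial>lebesgue_on L) < \<infinity>"
    using assms(3) \<open>compact L\<close> \<open>L \<subseteq> \<Omega>\<close> \<open>r > 0\<close> \<open>D \<ge> 1\<close>
    by (simp add: locally_integrable_def g_def)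
  obtain n where n: "(\<integral>\<^sup>+x. g x * indicator {x. g x > of_nat n} x \<partial>lebesgue_on L) < ennreal (1 / 2)"
    using nn_integral_tail_small[OF g_meas g_fin, of "ennreal (1 / 2)"]
    by (metis ennreal_less_zero_iff half_gt_zero_iff zero_less_one)
  \<comment> \<open>Multiplied by the weight bound \<open>n\<close>, this tolerance stays below 1/2,
    the share left by the tail; \<open>n + 1\<close> avoids division by zero.\<close>
  obtain d where "d > 0" and d: "\<And>h. norm h < d \<Longrightarrow>
      (\<integral>\<^sup>+x. ennreal \<bar>v (x + h) - v x\<bar> \<partial>lebesgue_on L) < ennreal (1 / (2 * (real n + 1)))"
    using L1_translation_continuous[OF v_meas v_bound compact_imp_bounded[OF \<open>compact L\<close>], 
        of "1 / (2 * (real n + 1))"] by auto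

  show "\<exists>\<eta>>0. \<forall>h. norm h < \<eta> \<longrightarrow>
      luxemburg_norm \<Omega> M (\<lambda>x. translation \<Omega> h u x - u x) < ennreal \<epsilon>"
  proof (intro exI conjI allI impI)
    show "min \<delta> d > 0" using \<open>\<delta> > 0\<close> \<open>d > 0\<close> by simp
    fix h :: "real ^ 'n" assume h: "norm h < min \<delta> d"
    define w where "w x = v (x + h) - v x" for x
    have w_bound: "\<bar>w x\<bar> \<le> D" for x
      using v_bound[of x] v_bound[of "x + h"] by (simp add: w_def D_def)
    have [measurable]: "w \<in> borel_measurable (lebesgue_on L)"
      unfolding w_def[abs_def]
      by (intro borel_measurable_diff measurable_restrict_space1 v_meas
          measurable_compose[OF measurable_lebesgue_add_right v_meas])
    have pt: "M x (\<bar>w x\<bar> / r) \<le> g x * indicator {x. g x > of_nat n} x + of_nat n * ennreal \<bar>w x\<bar>"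
      if "x \<in> \<Omega>" for x
    proof -
      have "M x (\<bar>w x\<bar> / r) \<le> ennreal (\<bar>w x\<bar> / r / (D / r)) * g x"
        unfolding g_def using phi that w_bound \<open>r > 0\<close> \<open>D \<ge> 1\<close>
        by (intro phi_function_le_scaled) (auto simp: divide_right_mono)
      also have "\<bar>w x\<bar> / r / (D / r) = \<bar>w x\<bar> / D"
        using \<open>r > 0\<close> by simp
      also have "ennreal (\<bar>w x\<bar> / D) * g x
          \<le> g x * indicator {x. g x > of_nat n} x + of_nat n * ennreal \<bar>w x\<bar>"
      \<comment> \<open>Where the weight is large, the factor \<open>\<bar>w x\<bar> / D\<close> is
        bounded by 1 and the tail term absorbs everything; elsewhere the weight is bounded by
        \<open>n\<close> and the smallness comes from \<open>\<bar>w x\<bar>\<close>.\<close>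
      proof (cases "g x > of_nat n")
        case True
        have "ennreal (\<bar>w x\<bar> / D) \<le> 1"
          using w_bound[of x] \<open>D \<ge> 1\<close> by simp
        then have "ennreal (\<bar>w x\<bar> / D) * g x \<le> 1 * g x"
          by (rule mult_right_mono) simp
        also have "\<dots> \<le> g x + of_nat n * ennreal \<bar>w x\<bar>" by simp
        finally show ?thesis using True by simp
      next
        case False
        have "\<bar>w x\<bar> / D \<le> \<bar>w x\<bar>"
          using \<open>D \<ge> 1\<close> by (simp add: divide_le_eq mult_left_mono[of 1 D "\<bar>w x\<bar>", simplified])
        then have "ennreal (\<bar>w x\<bar> / D) * g x \<le> ennreal \<bar>w x\<bar> * of_nat n"
          using False by (intro mult_mono ennreal_leI) auto
        then show ?thesis using False by (simp add: mult.commute)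
      qed
      finally show ?thesis .
    qed
    have "(\<integral>\<^sup>+x. M x (\<bar>translation \<Omega> h u x - u x\<bar> / r) \<partial>lebesgue_on \<Omega>)
        = (\<integral>\<^sup>+x. M x (\<bar>w x\<bar> / r) * indicator \<Omega> x \<partial>lebesgue)"
      by (simp add: nn_integral_restrict_space)
        (auto intro!: nn_integral_cong simp: trans_eq w_def indicator_def)
    \<comment> \<open>Off \<open>L\<close> the difference \<open>w\<close> vanishes because
      \<open>norm h < \<delta>\<close>, and \<open>M x 0 = 0\<close>.\<close>
    also have "\<dots> = (\<integral>\<^sup>+x. M x (\<bar>w x\<bar> / r) * indicator L x \<partial>lebesgue)"
    proof (rule nn_integral_cong)
      fix x
      have "M x (\<bar>w x\<bar> / r) = 0" if "x \<in> \<Omega>" "x \<notin> L"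
        using vanish[of x h] that h phi by (auto simp: w_def phi_function_def)
      then show "M x (\<bar>w x\<bar> / r) * indicator \<Omega> x = M x (\<bar>w x\<bar> / r) * indicator L x"
        using \<open>L \<subseteq> \<Omega>\<close> by (auto simp: indicator_def)
    qed
    also have "\<dots> = (\<integral>\<^sup>+x. M x (\<bar>w x\<bar> / r) \<partial>lebesgue_on L)"
      by (simp add: nn_integral_restrict_space)
    also have "\<dots> \<le> (\<integral>\<^sup>+x. g x * indicator {x. g x > of_nat n} x + of_nat n * ennreal \<bar>w x\<bar> \<partial>lebesgue_on L)"
      using \<open>L \<subseteq> \<Omega>\<close> by (intro nn_integral_mono pt) (auto simp: space_restrict_space)
    also have "\<dots> = (\<integral>\<^sup>+x. g x * indicator {x. g x > of_nat n} x \<partial>lebesgue_on L)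
        + of_nat n * (\<integral>\<^sup>+x. ennreal \<bar>w x\<bar> \<partial>lebesgue_on L)"
      by (simp add: nn_integral_add nn_integral_cmult)
    also have "\<dots> \<le> ennreal (1 / 2) + of_nat n * ennreal (1 / (2 * (real n + 1)))"
      using n d[of h] h by (intro add_mono mult_left_mono) (auto simp: w_def)
    also have "\<dots> = ennreal (1 / 2 + real n * (1 / (2 * (real n + 1))))"
      by (subst ennreal_plus) (simp_all add: ennreal_of_nat_eq_real_of_nat flip: ennreal_mult)
    also have "\<dots> \<le> ennreal 1"
      by (intro ennreal_leI) (simp add: divide_simps)
    \<comment> \<open>The modular at scale \<open>r\<close> is at most 1, so \<open>r\<close>
      belongs to the set whose infimum is the norm.\<close>
    finally have "luxemburg_norm \<Omega> M (\<lambda>x. translation \<Omega> h u x - u x) \<le> ennreal r"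
      unfolding luxemburg_norm_def using \<open>r > 0\<close> by (intro Inf_lower) (auto simp only: ennreal_1)
    also have "\<dots> < ennreal \<epsilon>"
      using \<open>\<epsilon> > 0\<close> by (simp add: r_def ennreal_less_iff)
    finally show "luxemburg_norm \<Omega> M (\<lambda>x. translation \<Omega> h u x - u x) < ennreal \<epsilon>" .
  qed
qed

end
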